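(* Let $Q=[0,1]\times[0,1]$ and let $\mu$ be two-dimensional Lebesgue measure on $Q$. For $\lambda\in[0,1]$ let $R^0(\lambda)=\{(x,y)\in Q : y\le\lambda\}$ and $R^1(\lambda)=\{(x,y)\in Q : y\ge 1-\lambda\}$, and let $\mathcal{R}^0=\{R^0(\lambda) : 0\le\lambda\le 1\}$. Define on $\mathcal{R}^0$ $$R^0(a)\oplus R^0(b)=R^0\big(\mu(R^0(a)\cup R^1(b))\big),\qquad R^0(a)\odot R^0(b)=R^0\big(\mu(R^0(a)\cap R^1(b))\big),$$ $$\neg R^0(a)=R^0\big(\mu(Q\setminus R^0(a))\big)=R^0(1-a),$$ and let $0=R^0(0)$, $1=R^0(1)=Q$. Then $(\mathcal{R}^0,\oplus,\neg,0,1)$ and $(\mathcal{R}^0,\odot,\neg,1,0)$ are MV-algebras (in the second, $1$ is the identity element of the monoid operation $\odot$).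
   Context: An MV-algebra is a structure $(A,+,\neg,e,u)$ such that $(A,+,e)$ is a commutative monoid with identity $e$, and for all $x,y\in A$: (i) $\neg(\neg x)=x$; (ii) $u+x=u$; (iii) $x+\neg e=\neg e$; (iv) $\neg(\neg x+y)+y=\neg(\neg y+x)+x$. *)

theory Defs
  imports "HOL-Analysis.Analysis" "HOL-Algebra.Group"
begin

locale mv_algebra =
  fixes A :: "'a set"
    and add :: "'a \<Rightarrow> 'a \<Rightarrow> 'a"
    and neg :: "'a \<Rightarrow> 'a"
    and e u :: 'a
  assumes add_comm_monoid: "comm_monoid \<lparr>carrier = A, monoid.mult = add, one = e\<rparr>"
    and neg_closed: "x \<in> A \<Longrightarrow> neg x \<in> A"
    and u_closed: "u \<in> A"
    and neg_neg: "x \<in> A \<Longrightarrow> neg (neg x) = x"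
    and u_add: "x \<in> A \<Longrightarrow> add u x = u"
    and add_neg_e: "x \<in> A \<Longrightarrow> add x (neg e) = neg e"
    and lukasiewicz: "\<lbrakk>x \<in> A; y \<in> A\<rbrakk> \<Longrightarrow>
      add (neg (add (neg x) y)) y = add (neg (add (neg y) x)) x"

definition Q :: "(real \<times> real) set" where
  "Q = {0..1} \<times> {0..1}"

definition \<mu> :: "(real \<times> real) set \<Rightarrow> real" where
  "\<mu> = measure (lebesgue_on Q)"

definition R0 :: "real \<Rightarrow> (real \<times> real) set" where
  "R0 l = {(x, y) \<in> Q. y \<le> l}"

definition R1 :: "real \<Rightarrow> (real \<times> real) set" where
  "R1 l = {(x, y) \<in> Q. y \<ge> 1 - l}"

definition RR0 :: "(real \<times> real) set set" where
  "RR0 = R0 ` {0..1}"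

text \<open>The binary operations are given on regions through their parameters, so the parameter
  of a region is recovered by inverting \<open>R0\<close>; injectivity of \<open>R0\<close> on the unit interval
  makes this well defined, and the intended equations are \<open>R0_oplus\<close> and \<open>R0_odot\<close> below.\<close>

definition level :: "(real \<times> real) set \<Rightarrow> real" where
  "level = the_inv_into {0..1} R0"

definition r_oplus :: "(real \<times> real) set \<Rightarrow> (real \<times> real) set \<Rightarrow> (real \<times> real) set" where
  "r_oplus X Y = R0 (\<mu> (X \<union> R1 (level Y)))"

definition r_odot :: "(real \<times> real) set \<Rightarrow> (real \<times> real) set \<Rightarrow> (real \<times> real) set" where
  "r_odot X Y = R0 (\<mu> (X \<inter> R1 (level Y)))"

definition r_neg :: "(real \<times> real) set \<Rightarrow> (real \<times> real) set" where
  "r_neg X = R0 (\<mu> (Q - X))"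

lemma inj_on_R0: "inj_on R0 {0..1}"
proof (rule inj_onI)
  fix a b :: real
  assume ab: "a \<in> {0..1}" "b \<in> {0..1}" and eq: "R0 a = R0 b"
  have "(0, a) \<in> R0 a" "(0, b) \<in> R0 b"
    using ab by (auto simp: R0_def Q_def)
  then have "(0, a) \<in> R0 b" "(0, b) \<in> R0 a"
    using eq by simp_all
  then show "a = b"
    by (auto simp: R0_def)
qed

lemma level_R0: "b \<in> {0..1} \<Longrightarrow> level (R0 b) = b"
  unfolding level_def by (rule the_inv_into_f_f[OF inj_on_R0])

lemma R0_oplus: "b \<in> {0..1} \<Longrightarrow> r_oplus (R0 a) (R0 b) = R0 (\<mu> (R0 a \<union> R1 b))"
  by (simp only: r_oplus_def level_R0)

lemma R0_odot: "b \<in> {0..1} \<Longrightarrow> r_odot (R0 a) (R0 b) = R0 (\<mu> (R0 a \<inter> R1 b))"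
  by (simp only: r_odot_def level_R0)

end

theory Submission
  imports Defs
begin

text \<open>The parameter map \<open>R0\<close> identifies the unit interval with \<open>RR0\<close>. Under it, the region
  operations become the truncated sum \<open>min 1 (a + b)\<close>, the Lukasiewicz product
  \<open>max 0 (a + b - 1)\<close> and the reflection \<open>1 - a\<close>, so the axioms reduce to
  piecewise linear arithmetic.\<close>

text \<open>As a box, a full-width strip gets its measurability and its measure from the content of
  \<open>cbox\<close>.\<close>

lemma strip_eq_cbox: "{0..1} \<times> {c..d} = cbox (0::real, c::real) (1, d)"
  by (simp add: cbox_Pair_eq)

lemma strip_lmeasurable: "{0..1::real} \<times> {c..d::real} \<in> lmeasurable"
  by (simp add: strip_eq_cbox)

lemma Q_lmeasurable: "Q \<in> lmeasurable"
  unfolding Q_def by (rule strip_lmeasurable)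

text \<open>Moves computations from the restricted space to \<open>lebesgue\<close>, where the box
  formulas apply.\<close>

lemma mu_eq_measure_lebesgue: "X \<subseteq> Q \<Longrightarrow> \<mu> X = measure lebesgue X"
  unfolding \<mu>_def by (rule measure_restrict_space) (use Q_lmeasurable in auto)

text \<open>The truncation at 0 covers the empty strip \<open>d < c\<close>; this is the case of
  \<open>R0 a \<inter> R1 b\<close> when \<open>a + b < 1\<close>.\<close>

lemma measure_strip: "measure lebesgue ({0..1::real} \<times> {c..d::real}) = max 0 (d - c)"
  by (auto simp: strip_eq_cbox content_Pair)

lemma R0_eq_strip: "a \<le> 1 \<Longrightarrow> R0 a = {0..1} \<times> {0..a}"
  by (auto simp: R0_def Q_def)

lemma R1_eq_strip: "b \<le> 1 \<Longrightarrow> R1 b = {0..1} \<times> {1 - b..1}"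
  by (auto simp: R1_def Q_def)

lemma R0_Int_R1_eq_strip: "\<lbrakk>a \<le> 1; b \<le> 1\<rbrakk> \<Longrightarrow> R0 a \<inter> R1 b = {0..1} \<times> {1 - b..a}"
  by (auto simp: R0_eq_strip R1_eq_strip)

lemma R0_subset_Q: "R0 a \<subseteq> Q"
  by (auto simp: R0_def)

lemma R1_subset_Q: "R1 b \<subseteq> Q"
  by (auto simp: R1_def)

lemma mu_R0_Int_R1:
  assumes "a \<in> {0..1}" "b \<in> {0..1}"
  shows "\<mu> (R0 a \<inter> R1 b) = max 0 (a + b - 1)"
proof -
  have "\<mu> (R0 a \<inter> R1 b) = measure lebesgue (R0 a \<inter> R1 b)"
    using R0_subset_Q by (blast intro: mu_eq_measure_lebesgue)
  with assms show ?thesis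
    by (simp add: R0_Int_R1_eq_strip measure_strip algebra_simps)
qed

lemma mu_R0_Un_R1:
  assumes "a \<in> {0..1}" "b \<in> {0..1}"
  shows "\<mu> (R0 a \<union> R1 b) = min 1 (a + b)"
proof -
  have "R0 a \<in> lmeasurable" "R1 b \<in> lmeasurable"
    using assms by (simp_all add: R0_eq_strip R1_eq_strip strip_lmeasurable)
  \<comment> \<open>Unlike the intersection, the union need not be a single strip, so
    inclusion-exclusion replaces a direct computation.\<close>
  then have "measure lebesgue (R0 a \<union> R1 b)
      = measure lebesgue (R0 a) + measure lebesgue (R1 b) - measure lebesgue (R0 a \<inter> R1 b)"
    by (rule measure_Un3)
  also have "measure lebesgue (R0 a \<inter> R1 b) = max 0 (a + b - 1)"
    using mu_R0_Int_R1[OF assms] mu_eq_measure_lebesgue[of "R0 a \<inter> R1 b"] R0_subset_Q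
    by fastforce
  also have "measure lebesgue (R0 a) + measure lebesgue (R1 b) - max 0 (a + b - 1)
      = a + b - max 0 (a + b - 1)"
    using assms by (simp add: R0_eq_strip R1_eq_strip measure_strip)
  also have "\<dots> = min 1 (a + b)"
    by auto
  finally show ?thesis
    by (simp add: mu_eq_measure_lebesgue R0_subset_Q R1_subset_Q)
qed

lemma mu_Q_diff_R0:
  assumes "a \<in> {0..1}"
  shows "\<mu> (Q - R0 a) = 1 - a"
proof -
  have "R0 a \<in> lmeasurable"
    using assms by (simp add: R0_eq_strip strip_lmeasurable)
  then have "measure lebesgue (Q - R0 a) = measure lebesgue Q - measure lebesgue (R0 a)"
    by (intro measurable_measure_Diff Q_lmeasurable R0_subset_Q fmeasurableD)
  then show ?thesis
    using assms by (simp add: mu_eq_measure_lebesgue Q_def R0_eq_strip measure_strip)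
qed

lemma r_oplus_R0:
  "\<lbrakk>a \<in> {0..1}; b \<in> {0..1}\<rbrakk> \<Longrightarrow> r_oplus (R0 a) (R0 b) = R0 (min 1 (a + b))"
  by (simp only: R0_oplus mu_R0_Un_R1)

lemma r_odot_R0:
  "\<lbrakk>a \<in> {0..1}; b \<in> {0..1}\<rbrakk> \<Longrightarrow> r_odot (R0 a) (R0 b) = R0 (max 0 (a + b - 1))"
  by (simp only: R0_odot mu_R0_Int_R1)

lemma r_neg_R0: "a \<in> {0..1} \<Longrightarrow> r_neg (R0 a) = R0 (1 - a)"
  by (simp only: r_neg_def mu_Q_diff_R0)

text \<open>The axioms are equations, so they pass to the image under a map that commutes with the
  operations.\<close>

lemma mv_algebra_image:
  assumes "mv_algebra A add neg e u"
    and add: "\<And>x y. \<lbrakk>x \<in> A; y \<in> A\<rbrakk> \<Longrightarrow> add' (f x) (f y) = f (add x y)"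
    and neg: "\<And>x. x \<in> A \<Longrightarrow> neg' (f x) = f (neg x)"
  shows "mv_algebra (f ` A) add' neg' (f e) (f u)"
proof -
  interpret mv_algebra A add neg e u by fact
  interpret M: comm_monoid "\<lparr>carrier = A, monoid.mult = add, one = e\<rparr>"
    by (rule add_comm_monoid)
  \<comment> \<open>Closure allows \<open>add\<close> and \<open>neg\<close> to rewrite nested
    terms, pulling \<open>f\<close> to the outside.\<close>
  note closed = M.m_closed[simplified] M.one_closed[simplified] neg_closed u_closed
  have "comm_monoid \<lparr>carrier = f ` A, monoid.mult = add', one = f e\<rparr>"
    using M.m_assoc M.m_comm M.l_one closed by (intro comm_monoidI) (auto simp: add)
  then show ?thesis
    by (rule mv_algebra.intro)
      (use closed in \<open>auto simp: add neg neg_neg u_add add_neg_e lukasiewicz\<close>)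
qed

text \<open>The standard MV-algebra on the unit interval: both sides of axiom (iv) equal
  \<open>max x y\<close>.\<close>

lemma mv_algebra_truncated_sum:
  "mv_algebra {0..1::real} (\<lambda>a b. min 1 (a + b)) (\<lambda>a. 1 - a) 0 1"
  by unfold_locales (auto simp: min_def)

text \<open>The dual of the truncated sum under \<open>a \<mapsto> 1 - a\<close>; here both sides of
  axiom (iv) equal \<open>min x y\<close>.\<close>

lemma mv_algebra_lukasiewicz_product:
  "mv_algebra {0..1::real} (\<lambda>a b. max 0 (a + b - 1)) (\<lambda>a. 1 - a) 1 0"
  by unfold_locales (auto simp: max_def)

theorem theorem5:
  shows "(\<forall>a\<in>{0..1}. r_neg (R0 a) = R0 (1 - a)) \<and> R0 1 = Q \<and>
    mv_algebra RR0 r_oplus r_neg (R0 0) (R0 1) \<and>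
    mv_algebra RR0 r_odot r_neg (R0 1) (R0 0)"
proof (intro conjI ballI)
  show "R0 1 = Q"
    by (auto simp: R0_def Q_def)
  show "mv_algebra RR0 r_oplus r_neg (R0 0) (R0 1)"
    unfolding RR0_def
    by (rule mv_algebra_image[OF mv_algebra_truncated_sum r_oplus_R0 r_neg_R0])
  show "mv_algebra RR0 r_odot r_neg (R0 1) (R0 0)"
    unfolding RR0_def
    by (rule mv_algebra_image[OF mv_algebra_lukasiewicz_product r_odot_R0 r_neg_R0])
qed (rule r_neg_R0)

end
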